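(* Let $G$ and $H$ be vertex-disjoint connected graphs, let $u_1,\dots,u_k$ be pairwise distinct vertices of $G$ and $v_1,\dots,v_k$ pairwise distinct vertices of $H$. If $G(\mathbf P)$ and $H(\mathbf P)$ are $T$-equivalent for every partition $\mathbf P$ of $\{1,\dots,k\}$, then for an arbitrary graph $W$ (vertex-disjoint from $G$ and $H$) with pairwise distinct vertices $w_1,\dots,w_k$, the graphs $G(u_1,\dots,u_k)\sqcup W(w_1,\dots,w_k)$ and $H(v_1,\dots,v_k)\sqcup W(w_1,\dots,w_k)$ are $T$-equivalent.
   Context: Graphs may have loops and parallel edges. The Tutte polynomial of $G=(V,E)$ is $T_G(x,y)=\sum_{A\subseteq E}(x-1)^{r(E)-r(A)}(y-1)^{|A|-r(A)}$ with $r(A)=|V|-c(A)$, $c(A)$ the number of components of $(V,A)$; two graphs are $T$-equivalent if they have the same Tutte polynomial. For a partition $\mathbf P=\{P_1,\dots,P_r\}$ of $\{1,\dots,k\}$, $G(\mathbf P)$ is the graph obtained from $G$ by identifying, for each $j\in\{1,\dots,r\}$, all vertices in $\{u_i:i\in P_j\}$ into one vertex (edges are kept, so edges between identified vertices become loops); $H(\mathbf P)$ is defined analogously with the $v_i$. For vertex-disjoint graphs $G,W$ with $u_1,\dots,u_k\in V(G)$, $w_1,\dots,w_k\in V(W)$, $G(u_1,\dots,u_k)\sqcup W(w_1,\dots,w_k)$ is obtained from $G$ and $W$ by identifying $u_i$ with $w_i$ for every $i$. *)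

theory Defs
  imports "HOL-Library.Disjoint_Sets" "HOL-Computational_Algebra.Polynomial"
begin

text \<open>Undirected multigraphs: each edge is sent to the set of its ends, which has two elements
  for an ordinary edge and one element for a loop.\<close>

record ('v, 'e) mgraph =
  verts :: "'v set"
  edges :: "'e set"
  ends :: "'e \<Rightarrow> 'v set"

definition wf_mgraph :: "('v, 'e) mgraph \<Rightarrow> bool" where
  "wf_mgraph G \<longleftrightarrow> finite (verts G) \<and> finite (edges G) \<and>
     (\<forall>e\<in>edges G. ends G e \<subseteq> verts G \<and> card (ends G e) \<in> {1, 2})"

definition gen_equiv :: "'v set \<Rightarrow> 'v rel \<Rightarrow> 'v rel" where
  "gen_equiv V R = (R \<union> R\<inverse>)\<^sup>* \<inter> V \<times> V"

definition adj :: "('v, 'e) mgraph \<Rightarrow> 'e set \<Rightarrow> 'v rel" where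
  "adj G A = {(x, y). \<exists>e\<in>A. ends G e = {x, y}}"

definition connected_mgraph :: "('v, 'e) mgraph \<Rightarrow> bool" where
  "connected_mgraph G \<longleftrightarrow>
     verts G \<noteq> {} \<and> (\<forall>x\<in>verts G. \<forall>y\<in>verts G. (x, y) \<in> (adj G (edges G))\<^sup>*)"

definition num_comps :: "('v, 'e) mgraph \<Rightarrow> 'e set \<Rightarrow> nat" where
  "num_comps G A = card (verts G // gen_equiv (verts G) (adj G A))"

text \<open>For a finite graph and \<open>A \<subseteq> edges G\<close> none of the natural-number subtractions below truncates:
  the number of components is at most the number of vertices, the rank is monotone, and the rank of
  a set of edges is at most its cardinality.\<close>

definition rank :: "('v, 'e) mgraph \<Rightarrow> 'e set \<Rightarrow> nat" where
  "rank G A = card (verts G) - num_comps G A"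

text \<open>Elements of \<open>\<int>[x, y]\<close> are represented as polynomials in \<open>y\<close> over \<open>\<int>[x]\<close>.\<close>

definition var_x :: "int poly poly" where "var_x = [:[:0, 1:]:]"

definition var_y :: "int poly poly" where "var_y = [:0, 1:]"

definition tutte_poly :: "('v, 'e) mgraph \<Rightarrow> int poly poly" where
  "tutte_poly G =
     (\<Sum>A\<in>Pow (edges G). (var_x - 1) ^ (rank G (edges G) - rank G A) *
                         (var_y - 1) ^ (card A - rank G A))"

definition T_equivalent :: "('v, 'e) mgraph \<Rightarrow> ('w, 'f) mgraph \<Rightarrow> bool" where
  "T_equivalent G H \<longleftrightarrow> tutte_poly G = tutte_poly H"

text \<open>Identification of the vertices related by \<open>R\<close>: the new vertices are the classes of the
  equivalence relation generated by \<open>R\<close>, and all edges are kept.\<close>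

definition identify :: "('v, 'e) mgraph \<Rightarrow> 'v rel \<Rightarrow> ('v set, 'e) mgraph" where
  "identify G R =
     \<lparr>verts = verts G // gen_equiv (verts G) R,
      edges = edges G,
      ends = (\<lambda>e. (\<lambda>x. gen_equiv (verts G) R `` {x}) ` ends G e)\<rparr>"

definition identify_partition ::
  "('v, 'e) mgraph \<Rightarrow> (nat \<Rightarrow> 'v) \<Rightarrow> nat set set \<Rightarrow> ('v set, 'e) mgraph" where
  "identify_partition G u P = identify G {(u i, u j) | i j. \<exists>B\<in>P. i \<in> B \<and> j \<in> B}"

text \<open>The vertex sets are meant to be disjoint; the edges are kept apart by the sum type.\<close>

definition disjoint_union ::
  "('v, 'e) mgraph \<Rightarrow> ('v, 'f) mgraph \<Rightarrow> ('v, 'e + 'f) mgraph" where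
  "disjoint_union G W =
     \<lparr>verts = verts G \<union> verts W,
      edges = edges G <+> edges W,
      ends = case_sum (ends G) (ends W)\<rparr>"

definition glue ::
  "nat \<Rightarrow> ('v, 'e) mgraph \<Rightarrow> (nat \<Rightarrow> 'v) \<Rightarrow> ('v, 'f) mgraph \<Rightarrow> (nat \<Rightarrow> 'v) \<Rightarrow>
     ('v set, 'e + 'f) mgraph" where
  "glue k G u W w = identify (disjoint_union G W) {(u i, w i) | i. i \<in> {1..k}}"

end

theory Submission
  imports Defs
begin

text \<open>Sort the edge sets of \<open>G \<squnion> W\<close> as \<open>A \<union> B\<close> with \<open>A \<subseteq> E(G)\<close>, \<open>B \<subseteq> E(W)\<close>. Fix \<open>B\<close>, let \<open>P\<close> be the
  partition of the terminals into the components of \<open>(V(W), B)\<close>, and let \<open>q(B)\<close> be the number of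
  components of \<open>(V(W), B)\<close> without terminals. The components of \<open>A \<union> B\<close> in \<open>G \<squnion> W\<close> are those of
  \<open>A\<close> in \<open>G(P)\<close> together with the \<open>q(B)\<close> terminal-free ones, and the rank of \<open>A \<union> B\<close> is the sum of
  the rank of \<open>A\<close> in \<open>G(P)\<close> and the rank of \<open>B\<close> in \<open>W\<close>. As \<open>G\<close> is connected, the sum over \<open>A\<close> is
  therefore the Tutte polynomial of \<open>G(P)\<close> times a factor depending only on \<open>W\<close> and \<open>B\<close>.\<close>

section \<open>Equivalence relations generated by a relation on a set\<close>

lemma equiv_gen_equiv: "equiv V (gen_equiv V R)"
proof (rule equivI)
  show "refl_on V (gen_equiv V R)" by (auto simp: gen_equiv_def refl_on_def)
  show "gen_equiv V R \<subseteq> V \<times> V" by (auto simp: gen_equiv_def)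
  have "sym ((R \<union> R\<inverse>)\<^sup>*)" by (intro sym_rtrancl) (auto simp: sym_def)
  then show "sym (gen_equiv V R)" by (auto simp: gen_equiv_def sym_def)
  show "trans (gen_equiv V R)" by (auto simp: gen_equiv_def trans_def)
qed

lemma gen_equiv_refl: "x \<in> V \<Longrightarrow> (x, x) \<in> gen_equiv V R"
  by (simp add: gen_equiv_def)

lemma gen_equiv_sym: "(x, y) \<in> gen_equiv V R \<Longrightarrow> (y, x) \<in> gen_equiv V R"
  using equiv_gen_equiv by (meson equivE symD)

lemma gen_equiv_trans:
  "(x, y) \<in> gen_equiv V R \<Longrightarrow> (y, z) \<in> gen_equiv V R \<Longrightarrow> (x, z) \<in> gen_equiv V R"
  using equiv_gen_equiv by (meson equivE transD)

lemma gen_equiv_subset: "gen_equiv V R \<subseteq> V \<times> V"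
  by (auto simp: gen_equiv_def)

lemma subset_gen_equiv: "R \<subseteq> V \<times> V \<Longrightarrow> R \<subseteq> gen_equiv V R"
  by (auto simp: gen_equiv_def)

text \<open>Upper bounds on a generated equivalence come from here without further induction on
  paths: it suffices to exhibit an equivalence, often the kernel of a function, that contains the
  generators.\<close>

lemma gen_equiv_least:
  assumes "R \<subseteq> E" "equiv V E"
  shows "gen_equiv V R \<subseteq> E"
proof -
  have E: "E \<subseteq> V \<times> V" "sym E" "trans E" and r: "\<And>x. x \<in> V \<Longrightarrow> (x, x) \<in> E"
    using assms(2) by (auto elim!: equivE dest: refl_onD)
  have "(x, y) \<in> E" if "(x, y) \<in> (R \<union> R\<inverse>)\<^sup>*" "x \<in> V" for x y
    using that
  proof (induction rule: rtrancl_induct)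
    case base
    then show ?case by (rule r)
  next
    case (step y z)
    then have "(y, z) \<in> E" using assms(1) E(2) by (auto dest: symD)
    with step show ?case using E(3) by (blast dest: transD)
  qed
  then show ?thesis by (auto simp: gen_equiv_def)
qed

lemma gen_equiv_mono: "R \<subseteq> S \<Longrightarrow> gen_equiv V R \<subseteq> gen_equiv V S"
  unfolding gen_equiv_def by (intro Int_mono rtrancl_mono) auto

lemma gen_equiv_of_equiv: "equiv V E \<Longrightarrow> gen_equiv V E = E"
  by (intro equalityI gen_equiv_least subset_gen_equiv) (auto elim: equivE)

lemma gen_equiv_eq_Id_on: "R \<subseteq> Id_on V \<Longrightarrow> gen_equiv V R = Id_on V"
proof (rule equalityI)
  assume "R \<subseteq> Id_on V"
  then show "gen_equiv V R \<subseteq> Id_on V"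
    by (rule gen_equiv_least) (auto intro!: equivI simp: refl_on_def sym_def trans_def)
  show "Id_on V \<subseteq> gen_equiv V R" by (auto intro: gen_equiv_refl)
qed

lemma equiv_kernel: "equiv V {(x, y). x \<in> V \<and> y \<in> V \<and> f x = f y}"
  by (auto intro!: equivI simp: refl_on_def sym_def trans_def)

text \<open>The restriction of \<open>gen_equiv V R\<close> to \<open>U\<close> is an equivalence on
  \<open>U\<close>. This transfers connections within one side of a gluing to the glued set.\<close>

lemma gen_equiv_le_gen_equiv:
  assumes "U \<subseteq> V" "S \<subseteq> U \<times> U" "S \<subseteq> gen_equiv V R"
  shows "gen_equiv U S \<subseteq> gen_equiv V R"
proof -
  have "equiv U (gen_equiv V R \<inter> U \<times> U)"
  proof (rule equivI)
    show "refl_on U (gen_equiv V R \<inter> U \<times> U)"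
      using assms(1) by (auto simp: refl_on_def intro: gen_equiv_refl)
    show "trans (gen_equiv V R \<inter> U \<times> U)"
      by (auto simp: trans_def intro: gen_equiv_trans)
  qed (auto simp: sym_def intro: gen_equiv_sym)
  with assms(2,3) have "gen_equiv U S \<subseteq> gen_equiv V R \<inter> U \<times> U"
    by (intro gen_equiv_least) auto
  then show ?thesis by simp
qed

section \<open>Counting classes: kernels, iterated quotients and gluings\<close>

lemma quotient_eq_image: "V // E = (\<lambda>x. E `` {x}) ` V"
  by (auto simp: quotient_def)

lemma quotient_gen_equiv_empty: "V // gen_equiv V {} = (\<lambda>x. {x}) ` V"
proof -
  have "gen_equiv V {} = Id_on V" by (rule gen_equiv_eq_Id_on) simp
  then show ?thesis by (auto simp: quotient_eq_image)
qed

text \<open>Taking images under \<open>f\<close> turns each class into a singleton, injectively. The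
  exact class counts below rest on such complete invariants.\<close>

lemma card_quotient_kernel:
  assumes "equiv V E" and "\<And>x y. x \<in> V \<Longrightarrow> y \<in> V \<Longrightarrow> (x, y) \<in> E \<longleftrightarrow> f x = f y"
  shows "card (V // E) = card (f ` V)"
proof -
  have img: "f ` (E `` {x}) = {f x}" if "x \<in> V" for x
  proof -
    have "E `` {x} \<subseteq> V" "x \<in> E `` {x}"
      using assms(1) that by (auto elim!: equivE dest: refl_onD)
    with assms(2) that show ?thesis by auto
  qed
  have "inj_on ((`) f) (V // E)"
  proof (rule inj_onI)
    fix X Y assume "X \<in> V // E" "Y \<in> V // E" "f ` X = f ` Y"
    then show "X = Y"
      by (elim quotientE) (simp add: img assms(2)[symmetric] equiv_class_eq_iff[OF assms(1)])
  qed
  then have "card (V // E) = card ((`) f ` (V // E))" by (simp add: card_image)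
  also have "(`) f ` (V // E) = (\<lambda>c. {c}) ` f ` V"
    by (auto simp: quotient_eq_image img image_iff)
  also have "card \<dots> = card (f ` V)" by (simp add: card_image)
  finally show ?thesis .
qed

lemma finite_quotient_gen_equiv: "finite V \<Longrightarrow> finite (V // gen_equiv V R)"
  by (rule finite_quotient) (use gen_equiv_subset in auto)

lemma card_quotient_gen_equiv_le: "finite V \<Longrightarrow> card (V // gen_equiv V R) \<le> card V"
  by (simp add: quotient_eq_image card_image_le)

text \<open>Saturation by the coarser relation maps the finer classes onto the coarser ones.\<close>

lemma card_quotient_gen_equiv_antimono:
  assumes "finite V" "R \<subseteq> S"
  shows "card (V // gen_equiv V S) \<le> card (V // gen_equiv V R)"
proof -
  have "(\<lambda>X. gen_equiv V S `` X) ` (V // gen_equiv V R) = V // gen_equiv V S"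
  proof -
    have *: "gen_equiv V S `` (gen_equiv V R `` {x}) = gen_equiv V S `` {x}" if "x \<in> V" for x
      using gen_equiv_mono[OF assms(2), of V] that
      by (auto intro: gen_equiv_trans gen_equiv_refl)
    show ?thesis
      by (simp add: quotient_eq_image image_image * cong: image_cong)
  qed
  then show ?thesis
    by (metis assms(1) card_image_le finite_quotient_gen_equiv)
qed

text \<open>The kernel of \<open>f\<close> is coarser than the equivalence generated by
  \<open>R\<close> and has one class per value of \<open>f\<close>.\<close>

lemma card_image_le_quotient:
  assumes "finite V" and "R \<subseteq> {(x, y). x \<in> V \<and> y \<in> V \<and> f x = f y}" (is "_ \<subseteq> ?E")
  shows "card (f ` V) \<le> card (V // gen_equiv V R)"
proof -
  have "card (f ` V) = card (V // gen_equiv V ?E)"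
    by (subst gen_equiv_of_equiv[OF equiv_kernel], subst card_quotient_kernel[OF equiv_kernel, of V f f]) auto
  with card_quotient_gen_equiv_antimono[OF assms] show ?thesis by simp
qed

text \<open>A new pair merges at most two classes; this bounds the effect of a single edge on the
  number of components.\<close>

lemma card_quotient_insert_pair:
  assumes "finite V" "R \<subseteq> V \<times> V" "x \<in> V" "y \<in> V"
  shows "card (V // gen_equiv V R) \<le> Suc (card (V // gen_equiv V (insert (x, y) (insert (y, x) R))))"
proof -
  let ?K = "gen_equiv V R"
  \<comment> \<open>\<open>f\<close> redirects the class of \<open>y\<close> to that of
    \<open>x\<close>. It is constant along \<open>R\<close> and along the new pair, and its values
    omit at most the class of \<open>y\<close>.\<close>
  define f where "f z = (if (y, z) \<in> ?K then ?K `` {x} else ?K `` {z})" for z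
  have cls: "?K `` {a} = ?K `` {b}" if "(a, b) \<in> ?K" for a b
    using that by (rule equiv_class_eq[OF equiv_gen_equiv])
  have "f a = f b" if "(a, b) \<in> R" for a b
    using subset_gen_equiv[OF assms(2)] that
    by (auto simp: f_def intro: gen_equiv_trans gen_equiv_sym cls dest!: subsetD)
  moreover have "f x = f y"
    using assms(4) by (auto simp: f_def gen_equiv_refl)
  ultimately have f: "card (f ` V) \<le> card (V // gen_equiv V (insert (x, y) (insert (y, x) R)))"
    using assms by (intro card_image_le_quotient) auto
  have "V // ?K \<subseteq> insert (?K `` {y}) (f ` V)"
  proof
    fix X assume "X \<in> V // ?K"
    then obtain z where "z \<in> V" "X = ?K `` {z}" by (rule quotientE)
    then show "X \<in> insert (?K `` {y}) (f ` V)"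
      using cls[of y z] by (cases "(y, z) \<in> ?K") (auto simp: f_def image_iff)
  qed
  then have "card (V // ?K) \<le> card (insert (?K `` {y}) (f ` V))"
    using assms(1) by (intro card_mono) auto
  also have "\<dots> \<le> Suc (card (f ` V))" by (simp add: card_insert_le_m1)
  finally show ?thesis using f by simp
qed

text \<open>A third isomorphism theorem: the map sending \<open>x\<close> to the
  \<open>?L\<close>-class of its \<open>K\<close>-class has kernel \<open>?M\<close>.\<close>

lemma card_quotient_quotient:
  assumes "R \<subseteq> V \<times> V" "S \<subseteq> V \<times> V"
  defines "K \<equiv> gen_equiv V R"
  shows "card ((V // K) // gen_equiv (V // K) {(K `` {x}, K `` {y}) | x y. (x, y) \<in> S}) =
         card (V // gen_equiv V (R \<union> S))" (is "card (_ // ?L) = card (_ // ?M)")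
proof -
  have L: "equiv (V // K) ?L" and M: "equiv V ?M" and K: "equiv V K"
    by (simp_all add: equiv_gen_equiv K_def)
  have RK: "R \<subseteq> K" unfolding K_def using assms(1) by (rule subset_gen_equiv)
  have KM: "K \<subseteq> ?M" unfolding K_def by (rule gen_equiv_mono) auto
  have SM: "S \<subseteq> ?M" using subset_gen_equiv[of "R \<union> S" V] assms(1,2) by auto
  have SL: "{(K `` {x}, K `` {y}) | x y. (x, y) \<in> S} \<subseteq> ?L"
    using assms(2) by (intro subset_gen_equiv) (auto intro: quotientI)
  have "(x, y) \<in> ?M \<longleftrightarrow> ?L `` {K `` {x}} = ?L `` {K `` {y}}" if xy: "x \<in> V" "y \<in> V" for x y
  proof
    assume "(x, y) \<in> ?M"
    moreover have "?M \<subseteq> {(x, y). x \<in> V \<and> y \<in> V \<and> ?L `` {K `` {x}} = ?L `` {K `` {y}}}"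
    proof (rule gen_equiv_least[OF _ equiv_kernel])
      have "K `` {a} = K `` {b}" if "(a, b) \<in> R" for a b
        using that RK equiv_class_eq[OF K] by blast
      moreover have "?L `` {K `` {a}} = ?L `` {K `` {b}}" if "(a, b) \<in> S" for a b
        using that SL by (intro equiv_class_eq[OF L]) blast
      ultimately have "?L `` {K `` {a}} = ?L `` {K `` {b}}" if "(a, b) \<in> R \<union> S" for a b
        using that by (elim UnE) (rule arg_cong[where f = "\<lambda>X. ?L `` {X}"], blast+)
      then show "R \<union> S \<subseteq> {(x, y). x \<in> V \<and> y \<in> V \<and> ?L `` {K `` {x}} = ?L `` {K `` {y}}}"
        using assms(1,2) by blast
    qed
    ultimately show "?L `` {K `` {x}} = ?L `` {K `` {y}}" by blast
  next
    have sat: "?M `` (K `` {a}) = ?M `` {a}" if "a \<in> V" for a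
      using KM that by (auto simp: K_def intro: gen_equiv_trans gen_equiv_refl)
    assume "?L `` {K `` {x}} = ?L `` {K `` {y}}"
    then have "(K `` {x}, K `` {y}) \<in> ?L"
      using xy by (simp add: eq_equiv_class_iff[OF L] quotientI)
    moreover have "?L \<subseteq> {(X, Y). X \<in> V // K \<and> Y \<in> V // K \<and> ?M `` X = ?M `` Y}"
    proof (rule gen_equiv_least[OF _ equiv_kernel], clarify)
      fix a b assume "(a, b) \<in> S"
      then have "a \<in> V" "b \<in> V" "?M `` {a} = ?M `` {b}"
        using assms(2) SM equiv_class_eq[OF M, of a b] by auto
      then show "K `` {a} \<in> V // K \<and> K `` {b} \<in> V // K \<and> ?M `` (K `` {a}) = ?M `` (K `` {b})"
        by (simp add: sat quotientI)
    qed
    ultimately have "?M `` {x} = ?M `` {y}" using sat[OF xy(1)] sat[OF xy(2)] by blast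
    then show "(x, y) \<in> ?M" using xy by (simp add: eq_equiv_class_iff[OF M])
  qed
  from card_quotient_kernel[OF M this]
  have "card (V // ?M) = card ((\<lambda>x. ?L `` {K `` {x}}) ` V)" by simp
  also have "(\<lambda>x. ?L `` {K `` {x}}) ` V = (V // K) // ?L"
    unfolding quotient_eq_image[of _ ?L] by (simp add: quotient_eq_image image_image)
  finally show ?thesis by simp
qed

text \<open>A glued class that misses \<open>V\<close> contains no \<open>w i\<close>, hence is a
  terminal-free class of \<open>S\<close>. A glued class that meets \<open>V\<close> is determined
  by its trace on \<open>V\<close>, which is a class for \<open>R\<close> enlarged by shortcuts
  between those \<open>u i\<close> and \<open>u j\<close> whose partners are joined through
  \<open>U\<close>.\<close>

lemma card_quotient_glue:
  fixes u w :: "'i \<Rightarrow> 'v"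
  assumes fin: "finite V" "finite U" and disj: "V \<inter> U = {}"
    and uV: "u ` I \<subseteq> V" and wU: "w ` I \<subseteq> U" and R: "R \<subseteq> V \<times> V" and S: "S \<subseteq> U \<times> U"
  shows "card ((V \<union> U) // gen_equiv (V \<union> U) ({(u i, w i) | i. i \<in> I} \<union> (R \<union> S))) =
    card (V // gen_equiv V ({(u i, u j) | i j. i \<in> I \<and> j \<in> I \<and> (w i, w j) \<in> gen_equiv U S} \<union> R))
    + card {C \<in> U // gen_equiv U S. C \<inter> w ` I = {}}"
    (is "card (_ // gen_equiv _ ?X) = card (_ // gen_equiv _ ?Y) + card ?Q")
proof -
  let ?E = "gen_equiv (V \<union> U) ?X"
  define F where "F = gen_equiv V ?Y"
  define K where "K = gen_equiv U S"
  have eqF: "equiv V F" and eqK: "equiv U K" by (simp_all add: F_def K_def equiv_gen_equiv)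
  have XE: "?X \<subseteq> ?E" using uV wU R S by (intro subset_gen_equiv) auto
  have YF: "?Y \<subseteq> F" unfolding F_def using uV R by (intro subset_gen_equiv) auto
  have SK: "S \<subseteq> K" unfolding K_def using S by (rule subset_gen_equiv)
  have KU: "K \<subseteq> U \<times> U" unfolding K_def by (rule gen_equiv_subset)
  have KE: "K \<subseteq> ?E"
    unfolding K_def using XE S by (intro gen_equiv_le_gen_equiv) auto
  have uE: "(u i, z) \<in> ?E" if "i \<in> I" "(w i, z) \<in> K" for i z
  proof (rule gen_equiv_trans)
    show "(u i, w i) \<in> ?E" using XE that(1) by blast
    show "(w i, z) \<in> ?E" using KE that(2) by blast
  qed
  have FE: "F \<subseteq> ?E"
  proof -
    have "(u i, u j) \<in> ?E" if ij: "i \<in> I" "j \<in> I" "(w i, w j) \<in> K" for i j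
    proof (rule gen_equiv_trans)
      show "(u i, w j) \<in> ?E" using ij by (intro uE)
      show "(w j, u j) \<in> ?E" by (rule gen_equiv_sym) (use XE ij(2) in blast)
    qed
    then have "?Y \<subseteq> ?E" using XE unfolding K_def by blast
    then show ?thesis
      unfolding F_def using uV R by (intro gen_equiv_le_gen_equiv) auto
  qed
  \<comment> \<open>Some terminal index reaching \<open>z\<close> inside \<open>U\<close>. Where
    there is none the value is arbitrary, and \<open>g\<close> does not consult it.\<close>
  define t where "t z = (SOME i. i \<in> I \<and> (w i, z) \<in> K)" for z
  \<comment> \<open>A complete invariant of the glued classes: the \<open>F\<close>-class in \<open>V\<close> met by the class, if any,
    and otherwise the \<open>K\<close>-class itself.\<close>
  define g :: "'v \<Rightarrow> 'v set + 'v set" where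
    "g z = (if z \<in> V then Inl (F `` {z})
            else if \<exists>i\<in>I. (w i, z) \<in> K then Inl (F `` {u (t z)}) else Inr (K `` {z}))" for z
  have g_V: "g z = Inl (F `` {z})" if "z \<in> V" for z
    using that by (simp add: g_def)
  have t: "t z \<in> I" "(w (t z), z) \<in> K" if "i \<in> I" "(w i, z) \<in> K" for i z
    using someI[of "\<lambda>i. i \<in> I \<and> (w i, z) \<in> K"] that by (auto simp: t_def)
  \<comment> \<open>The choice made by \<open>t\<close> is immaterial: terminals in one
    \<open>K\<close>-class have their partners paired directly in \<open>?Y\<close>, hence in one
    \<open>F\<close>-class.\<close>
  have g_terminal: "g z = Inl (F `` {u i})" if i: "i \<in> I" "(w i, z) \<in> K" for i z
  proof -
    have "(w i, w (t z)) \<in> K"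
      using i t[OF i] unfolding K_def by (meson gen_equiv_sym gen_equiv_trans)
    then have "(u i, u (t z)) \<in> F" using YF i t[OF i] by (auto simp: K_def)
    moreover have "z \<notin> V" using i KU disj by auto
    ultimately show ?thesis
      using i equiv_class_eq[OF eqF] by (auto simp: g_def)
  qed
  have g_free: "g z = Inr (K `` {z})" if "z \<in> U" "\<not> (\<exists>i\<in>I. (w i, z) \<in> K)" for z
    using that disj by (auto simp: g_def)
  have g_K: "g a = g b" if "(a, b) \<in> K" for a b
  proof (cases "\<exists>i\<in>I. (w i, a) \<in> K")
    case True
    then obtain i where "i \<in> I" "(w i, a) \<in> K" by auto
    moreover from this have "(w i, b) \<in> K" using that unfolding K_def by (meson gen_equiv_trans)
    ultimately show ?thesis by (simp add: g_terminal)
  next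
    case False
    then have "\<not> (\<exists>i\<in>I. (w i, b) \<in> K)"
      using that unfolding K_def by (meson gen_equiv_trans gen_equiv_sym)
    then show ?thesis
      using False that KU equiv_class_eq[OF eqK that] by (subst (1 2) g_free) auto
  qed
  have "?X \<subseteq> {(x, y). x \<in> V \<union> U \<and> y \<in> V \<union> U \<and> g x = g y}"
  proof -
    have "g (u i) = g (w i)" if "i \<in> I" for i
    proof -
      have "u i \<in> V" "(w i, w i) \<in> K" using that uV wU by (auto simp: K_def gen_equiv_refl)
      then show ?thesis using g_V g_terminal[OF that] by simp
    qed
    moreover have "g a = g b" if "(a, b) \<in> R" for a b
    proof -
      have "a \<in> V" "b \<in> V" "(a, b) \<in> F" using that R YF by auto
      then show ?thesis using equiv_class_eq[OF eqF, of a b] by (simp add: g_V)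
    qed
    moreover have "g a = g b" if "(a, b) \<in> S" for a b
      using that SK g_K by auto
    ultimately show ?thesis using uV wU R S by blast
  qed
  then have E_g: "?E \<subseteq> {(x, y). x \<in> V \<union> U \<and> y \<in> V \<union> U \<and> g x = g y}"
    by (rule gen_equiv_least[OF _ equiv_kernel])
  \<comment> \<open>A normal form for the converse: \<open>z\<close> is moved within its glued class
    to a point of \<open>V\<close>, or \<open>g\<close> displays its \<open>K\<close>-class. Equal
    values of \<open>g\<close> then give related points, because \<open>F\<close> and
    \<open>K\<close> are contained in \<open>?E\<close>.\<close>
  have rep: "(\<exists>a\<in>V. g z = Inl (F `` {a}) \<and> (z, a) \<in> ?E) \<or> z \<in> U \<and> g z = Inr (K `` {z})"
    if z: "z \<in> V \<union> U" for z
  proof (cases "\<exists>i\<in>I. (w i, z) \<in> K")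
    case True
    then obtain i where i: "i \<in> I" "(w i, z) \<in> K" by auto
    then have "(z, u i) \<in> ?E" by (rule gen_equiv_sym[OF uE])
    then show ?thesis using g_terminal[OF i] i uV by auto
  next
    case False
    then show ?thesis using z g_V[of z] g_free[of z] gen_equiv_refl[OF z] by auto
  qed
  have "(x, y) \<in> ?E \<longleftrightarrow> g x = g y" if xy: "x \<in> V \<union> U" "y \<in> V \<union> U" for x y
  proof
    assume g: "g x = g y"
    from rep[OF xy(1)] show "(x, y) \<in> ?E"
    proof
      assume "\<exists>a\<in>V. g x = Inl (F `` {a}) \<and> (x, a) \<in> ?E"
      then obtain a where a: "a \<in> V" "g x = Inl (F `` {a})" "(x, a) \<in> ?E" by auto
      with rep[OF xy(2)] g obtain b where b: "b \<in> V" "g y = Inl (F `` {b})" "(y, b) \<in> ?E" by auto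
      have "F `` {a} = F `` {b}" using a(2) b(2) g by simp
      then have "(a, b) \<in> ?E" using FE eq_equiv_class_iff[OF eqF a(1) b(1)] by blast
      then show ?thesis by (rule gen_equiv_trans[OF gen_equiv_trans[OF a(3)] gen_equiv_sym[OF b(3)]])
    next
      assume a: "x \<in> U \<and> g x = Inr (K `` {x})"
      with rep[OF xy(2)] g have "y \<in> U" "K `` {x} = K `` {y}" by auto
      then show ?thesis using KE a eq_equiv_class_iff[OF eqK, of x y] by blast
    qed
  qed (use E_g in auto)
  then have "card ((V \<union> U) // ?E) = card (g ` (V \<union> U))"
    by (rule card_quotient_kernel[OF equiv_gen_equiv])
  \<comment> \<open>The two summands of the sum type become the two terms of the count: all
    \<open>F\<close>-classes on the left, exactly the terminal-free \<open>K\<close>-classes on the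
    right.\<close>
  also have "g ` (V \<union> U) = Inl ` (V // F) \<union> Inr ` ?Q"
  proof (intro equalityI subsetI)
    fix c assume "c \<in> g ` (V \<union> U)"
    then obtain z where z: "z \<in> V \<union> U" "c = g z" by auto
    show "c \<in> Inl ` (V // F) \<union> Inr ` ?Q"
    proof (cases "\<exists>i\<in>I. (w i, z) \<in> K")
      case True
      then obtain i where "i \<in> I" "c = Inl (F `` {u i})" using g_terminal z(2) by auto
      moreover from this have "F `` {u i} \<in> V // F" using uV by (intro quotientI) auto
      ultimately show ?thesis by simp
    next
      case False
      then have "K `` {z} \<inter> w ` I = {}" unfolding K_def by (blast intro: gen_equiv_sym)
      then have "K `` {z} \<in> ?Q" if "z \<in> U" using quotientI[OF that, of K] by (simp add: K_def)
      moreover have "F `` {z} \<in> V // F" if "z \<in> V" using that by (rule quotientI)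
      ultimately show ?thesis using z g_V g_free False by auto
    qed
  next
    fix c assume "c \<in> Inl ` (V // F) \<union> Inr ` ?Q"
    then show "c \<in> g ` (V \<union> U)"
    proof
      assume "c \<in> Inl ` (V // F)"
      then obtain z where "z \<in> V" "c = g z" using g_V by (auto elim!: quotientE)
      then show ?thesis by simp
    next
      assume "c \<in> Inr ` ?Q"
      then obtain z where z: "z \<in> U" "c = Inr (K `` {z})" "K `` {z} \<inter> w ` I = {}"
        by (auto elim!: quotientE simp: K_def)
      then have "\<not> (\<exists>i\<in>I. (w i, z) \<in> K)" unfolding K_def by (blast intro: gen_equiv_sym)
      with z have "c = g z" using g_free by simp
      with z(1) show ?thesis by simp
    qed
  qed
  also have "card \<dots> = card (V // F) + card ?Q"
    using finite_quotient_gen_equiv[OF fin(1), of ?Y] finite_quotient_gen_equiv[OF fin(2), of S]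
    by (subst card_Un_disjoint) (auto simp: F_def card_image)
  finally show ?thesis by (simp add: F_def)
qed

lemma gen_equiv_Un_converse: "gen_equiv V (R\<inverse> \<union> S) = gen_equiv V (R \<union> S)"
proof -
  have "R\<inverse> \<union> S \<union> (R\<inverse> \<union> S)\<inverse> = R \<union> S \<union> (R \<union> S)\<inverse>" by auto
  then show ?thesis by (simp add: gen_equiv_def)
qed

text \<open>With no relation on \<open>V\<close>, each \<open>u i\<close> is absorbed by its partner
  and all other points of \<open>V\<close> stay alone. The additive form avoids truncated
  subtraction. It yields the vertex counts of the glued graph and, for general \<open>S\<close>, of
  the identified graphs.\<close>

lemma card_quotient_glue_discrete:
  assumes fin: "finite V" "finite U" and disj: "V \<inter> U = {}"
    and uV: "u ` I \<subseteq> V" and inj: "inj_on u I" and wU: "w ` I \<subseteq> U" and S: "S \<subseteq> U \<times> U"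
  shows "card ((V \<union> U) // gen_equiv (V \<union> U) ({(u i, w i) | i. i \<in> I} \<union> S)) + card I =
    card (U // gen_equiv U S) + card V"
proof -
  \<comment> \<open>The gluing formula with the two sides exchanged and no edges on \<open>V\<close>.\<close>
  have Id: "gen_equiv V {} = Id_on V" by (rule gen_equiv_eq_Id_on) simp
  let ?D = "{(w i, w j) | i j. i \<in> I \<and> j \<in> I \<and> (u i, u j) \<in> gen_equiv V {}}"
  \<comment> \<open>By injectivity of \<open>u\<close> the shortcuts are diagonal pairs, which add
    nothing.\<close>
  have "?D \<subseteq> gen_equiv U S"
    using inj_onD[OF inj] wU by (fastforce simp: Id intro: gen_equiv_refl)
  then have "gen_equiv U (?D \<union> S) = gen_equiv U S"
    using subset_gen_equiv[OF S]
    by (intro equalityI gen_equiv_least gen_equiv_mono equiv_gen_equiv) auto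
  moreover have "card {C \<in> V // gen_equiv V {}. C \<inter> u ` I = {}} = card V - card I"
  proof -
    have "{C \<in> V // gen_equiv V {}. C \<inter> u ` I = {}} = (\<lambda>x. {x}) ` (V - u ` I)"
      by (auto simp: quotient_gen_equiv_empty)
    then show ?thesis
      using fin(1) uV by (simp add: card_image card_Diff_subset finite_subset inj)
  qed
  ultimately have "card ((U \<union> V) // gen_equiv (U \<union> V) ({(w i, u i) | i. i \<in> I} \<union> S)) =
      card (U // gen_equiv U S) + (card V - card I)"
    using card_quotient_glue[OF fin(2,1) _ wU uV S, of "{}"] disj by (simp add: Int_commute)
  moreover have "{(w i, u i) | i. i \<in> I} = {(u i, w i) | i. i \<in> I}\<inverse>" by auto
  moreover have "card I \<le> card V"
    using fin(1) uV card_mono[of V "u ` I"] by (simp add: card_image inj)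
  ultimately show ?thesis
    by (simp add: gen_equiv_Un_converse Un_commute[of V U])
qed

section \<open>Components and rank of multigraphs; identification and disjoint union\<close>

lemma wf_mgraph_ends:
  assumes "wf_mgraph G" "e \<in> edges G"
  obtains x y where "x \<in> verts G" "y \<in> verts G" "ends G e = {x, y}"
proof -
  have "ends G e \<subseteq> verts G" "card (ends G e) = 1 \<or> card (ends G e) = 2"
    using assms by (auto simp: wf_mgraph_def)
  then show thesis using that by (auto simp: card_2_iff card_1_singleton_iff)
qed

lemma adj_subset: "wf_mgraph G \<Longrightarrow> A \<subseteq> edges G \<Longrightarrow> adj G A \<subseteq> verts G \<times> verts G"
  unfolding adj_def wf_mgraph_def by blast

lemma adj_mono: "A \<subseteq> B \<Longrightarrow> adj G A \<subseteq> adj G B"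
  by (auto simp: adj_def)

lemma num_comps_le: "finite (verts G) \<Longrightarrow> num_comps G A \<le> card (verts G)"
  by (simp add: num_comps_def card_quotient_gen_equiv_le)

lemma num_comps_antimono: "finite (verts G) \<Longrightarrow> A \<subseteq> B \<Longrightarrow> num_comps G B \<le> num_comps G A"
  by (simp add: num_comps_def card_quotient_gen_equiv_antimono adj_mono)

text \<open>Starting from no edges, each further edge lowers the number of components by at most
  one. This keeps the exponents of \<open>var_y - 1\<close> from truncating.\<close>

lemma rank_le_card:
  assumes G: "wf_mgraph G" and "A \<subseteq> edges G"
  shows "rank G A \<le> card A"
proof -
  have V: "finite (verts G)" and "finite A"
    using assms by (auto simp: wf_mgraph_def intro: finite_subset)
  from this(2) assms(2) have "card (verts G) \<le> num_comps G A + card A"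
  proof (induction A)
    case empty
    show ?case by (simp add: num_comps_def adj_def quotient_gen_equiv_empty card_image)
  next
    case (insert e A)
    obtain x y where e: "x \<in> verts G" "y \<in> verts G" "ends G e = {x, y}"
      using wf_mgraph_ends[OF G] insert.prems by auto
    \<comment> \<open>\<open>adj\<close> records an edge in both directions; for a loop the two
      pairs coincide.\<close>
    have "adj G (insert e A) = insert (x, y) (insert (y, x) (adj G A))"
      using e by (auto simp: adj_def doubleton_eq_iff)
    then have "num_comps G A \<le> Suc (num_comps G (insert e A))"
      using card_quotient_insert_pair[OF V adj_subset[OF G, of A] e(1,2)] insert.prems
      by (simp add: num_comps_def)
    with insert show ?case by simp
  qed
  then show ?thesis by (simp add: rank_def)
qed

lemma wf_identify:
  assumes "wf_mgraph G"
  shows "wf_mgraph (identify G R)"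
  unfolding wf_mgraph_def
proof (intro conjI ballI)
  fix e assume "e \<in> edges (identify G R)"
  then obtain x y where "x \<in> verts G" "y \<in> verts G" "ends G e = {x, y}"
    using wf_mgraph_ends[OF assms] by (auto simp: identify_def)
  then show "ends (identify G R) e \<subseteq> verts (identify G R)" "card (ends (identify G R) e) \<in> {1, 2}"
    by (auto simp: identify_def card_insert_if intro: quotientI)
qed (use assms in \<open>auto simp: identify_def wf_mgraph_def finite_quotient_gen_equiv\<close>)

text \<open>Edges of the identified graph join the classes of the original ends, so its components
  form an iterated quotient. Counting on the original vertices makes the gluing formula
  applicable.\<close>

lemma num_comps_identify:
  assumes G: "wf_mgraph G" and A: "A \<subseteq> edges G" and R: "R \<subseteq> verts G \<times> verts G"
  shows "num_comps (identify G R) A = card (verts G // gen_equiv (verts G) (R \<union> adj G A))"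
proof -
  let ?K = "gen_equiv (verts G) R"
  have "adj (identify G R) A = {(?K `` {x}, ?K `` {y}) | x y. (x, y) \<in> adj G A}"
  proof (intro equalityI subsetI)
    fix p assume "p \<in> adj (identify G R) A"
    then obtain X Y e where p: "p = (X, Y)" "e \<in> A" "(\<lambda>x. ?K `` {x}) ` ends G e = {X, Y}"
      by (auto simp: adj_def identify_def)
    obtain x y where e: "ends G e = {x, y}" using wf_mgraph_ends[OF G subsetD[OF A p(2)]] by metis
    then have "(x, y) \<in> adj G A" "(y, x) \<in> adj G A" using p by (auto simp: adj_def)
    moreover have "X = ?K `` {x} \<and> Y = ?K `` {y} \<or> X = ?K `` {y} \<and> Y = ?K `` {x}"
      using p(3) unfolding e by (simp add: doubleton_eq_iff) blast
    ultimately show "p \<in> {(?K `` {x}, ?K `` {y}) | x y. (x, y) \<in> adj G A}"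
      using p(1) by blast
  next
    fix p assume "p \<in> {(?K `` {x}, ?K `` {y}) | x y. (x, y) \<in> adj G A}"
    then obtain x y e where "p = (?K `` {x}, ?K `` {y})" "e \<in> A" "ends G e = {x, y}"
      by (auto simp: adj_def)
    then show "p \<in> adj (identify G R) A" by (auto simp: adj_def identify_def intro!: bexI[of _ e])
  qed
  then show ?thesis
    using card_quotient_quotient[OF R adj_subset[OF G A]]
    by (simp add: num_comps_def identify_def)
qed

lemma wf_disjoint_union: "wf_mgraph G \<Longrightarrow> wf_mgraph W \<Longrightarrow> wf_mgraph (disjoint_union G W)"
  unfolding wf_mgraph_def disjoint_union_def by (simp add: Plus_def ball_Un) blast

lemma adj_disjoint_union: "adj (disjoint_union G W) (A <+> B) = adj G A \<union> adj W B"
  by (auto simp: adj_def disjoint_union_def Plus_def bex_Un)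

section \<open>The components of \<open>W\<close> and the partition they induce on the
  terminals\<close>

definition terminal_free_comps :: "('v, 'e) mgraph \<Rightarrow> 'v set \<Rightarrow> 'e set \<Rightarrow> nat" where
  "terminal_free_comps W T B =
     card {C \<in> verts W // gen_equiv (verts W) (adj W B). C \<inter> T = {}}"

text \<open>The blocks consist of indices rather than vertices, so that one and the same partition
  can be applied to both \<open>G\<close> and \<open>H\<close>.\<close>

definition induced_partition ::
  "'i set \<Rightarrow> ('v, 'e) mgraph \<Rightarrow> ('i \<Rightarrow> 'v) \<Rightarrow> 'e set \<Rightarrow> 'i set set" where
  "induced_partition I W w B =
     I // {(i, j). i \<in> I \<and> j \<in> I \<and> (w i, w j) \<in> gen_equiv (verts W) (adj W B)}"

lemma equiv_same_comp:
  assumes "w ` I \<subseteq> U"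
  shows "equiv I {(i, j). i \<in> I \<and> j \<in> I \<and> (w i, w j) \<in> gen_equiv U S}"
proof (rule equivI)
  show "refl_on I {(i, j). i \<in> I \<and> j \<in> I \<and> (w i, w j) \<in> gen_equiv U S}"
    using assms by (auto simp: refl_on_def intro!: gen_equiv_refl)
  show "sym {(i, j). i \<in> I \<and> j \<in> I \<and> (w i, w j) \<in> gen_equiv U S}"
    by (auto simp: sym_def intro: gen_equiv_sym)
  show "trans {(i, j). i \<in> I \<and> j \<in> I \<and> (w i, w j) \<in> gen_equiv U S}"
    by (auto simp: trans_def intro: gen_equiv_trans)
qed auto

lemma partition_on_induced_partition:
  "w ` I \<subseteq> verts W \<Longrightarrow> partition_on I (induced_partition I W w B)"
  unfolding induced_partition_def by (intro partition_on_quotient equiv_same_comp)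

text \<open>Blocks are classes of an equivalence, so sharing a block means being related. The
  identification is thereby expressed by the shortcuts of \<open>card_quotient_glue\<close>.\<close>

lemma identify_induced_partition:
  assumes "w ` I \<subseteq> verts W"
  shows "identify_partition G u (induced_partition I W w B) =
    identify G {(u i, u j) | i j. i \<in> I \<and> j \<in> I \<and> (w i, w j) \<in> gen_equiv (verts W) (adj W B)}"
proof -
  have "(\<exists>X \<in> induced_partition I W w B. i \<in> X \<and> j \<in> X) \<longleftrightarrow>
      i \<in> I \<and> j \<in> I \<and> (w i, w j) \<in> gen_equiv (verts W) (adj W B)" for i j
    unfolding induced_partition_def
    using in_quotient_imp_in_rel[OF equiv_same_comp[OF assms, of "adj W B"], of _ i j]
      equiv_class_self[OF equiv_same_comp[OF assms, of "adj W B"], of i]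
    by (auto intro!: bexI[OF _ quotientI])
  then show ?thesis by (simp add: identify_partition_def)
qed

text \<open>Paths survive identification. The constant value 1 lets the exponent of
  \<open>var_x - 1\<close> split into a part from \<open>W\<close> and a part from the identified
  graph.\<close>

lemma num_comps_identify_connected:
  assumes G: "wf_mgraph G" "connected_mgraph G" and R: "R \<subseteq> verts G \<times> verts G"
  shows "num_comps (identify G R) (edges G) = 1"
proof -
  have "(adj G (edges G))\<^sup>* \<subseteq> (R \<union> adj G (edges G) \<union> (R \<union> adj G (edges G))\<inverse>)\<^sup>*"
    by (intro rtrancl_mono) auto
  then have "gen_equiv (verts G) (R \<union> adj G (edges G)) = verts G \<times> verts G"
    using G(2) by (auto simp: gen_equiv_def connected_mgraph_def)
  moreover have "verts G // (verts G \<times> verts G) = {verts G}"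
    using G(2) by (auto simp: quotient_eq_image connected_mgraph_def)
  ultimately show ?thesis using num_comps_identify[OF G(1) subset_refl R] by simp
qed

section \<open>Expansion of the Tutte polynomial of a glued graph\<close>

lemma bij_betw_Plus_Pow:
  "bij_betw (\<lambda>(B, A). A <+> B) (Pow F \<times> Pow E) (Pow (E <+> F))"
  by (rule bij_betwI[where g = "\<lambda>C. (Inr -` C, Inl -` C)"]) (auto simp: Plus_def)

text \<open>The factors in front of the Tutte polynomials depend only on \<open>W\<close>, the
  terminals \<open>w i\<close> and \<open>B\<close>, so \<open>G\<close> enters only through its
  identified graphs. They split off because both exponents are additive.\<close>

lemma tutte_poly_glue:
  assumes G: "wf_mgraph G" "connected_mgraph G" and W: "wf_mgraph W"
    and disj: "verts W \<inter> verts G = {}"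
    and u: "u ` {1..k} \<subseteq> verts G" "inj_on u {1..k}" and w: "w ` {1..k} \<subseteq> verts W"
  defines "q \<equiv> terminal_free_comps W (w ` {1..k})"
  shows "tutte_poly (glue k G u W w) =
    (\<Sum>B\<in>Pow (edges W). (var_x - 1) ^ (q B - q (edges W)) * (var_y - 1) ^ (card B - rank W B) *
       tutte_poly (identify_partition G u (induced_partition {1..k} W w B)))"
proof -
  let ?Z = "glue k G u W w" and ?D = "disjoint_union G W" and ?I = "{1..k}"
  let ?J = "{(u i, w i) | i. i \<in> ?I}"
  define T where "T B = {(u i, u j) | i j. i \<in> ?I \<and> j \<in> ?I \<and>
    (w i, w j) \<in> gen_equiv (verts W) (adj W B)}" for B
  let ?P = "\<lambda>B. identify G (T B)"
  have fin: "finite (verts G)" "finite (verts W)" "finite (edges G)" "finite (edges W)"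
    using G W by (auto simp: wf_mgraph_def)
  have disj': "verts G \<inter> verts W = {}" using disj by auto
  have wfD: "wf_mgraph ?D" using G(1) W by (rule wf_disjoint_union)
  have wfZ: "wf_mgraph ?Z" unfolding glue_def using wfD by (rule wf_identify)
  have vD: "verts ?D = verts G \<union> verts W" and eD: "edges ?D = edges G <+> edges W"
    by (simp_all add: disjoint_union_def)
  have eZ: "edges ?Z = edges G <+> edges W" by (simp add: glue_def identify_def eD)
  have finZ: "finite (verts ?Z)" using wfZ by (simp add: wf_mgraph_def)
  have T: "T B \<subseteq> verts G \<times> verts G" for B using u(1) by (auto simp: T_def)
  have wfP: "wf_mgraph (?P B)" for B using G(1) by (rule wf_identify)
  have finP: "finite (verts (?P B))" for B using wfP[of B] by (simp add: wf_mgraph_def)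
  have cZ: "num_comps ?Z (A <+> B) = num_comps (?P B) A + q B"
    if "A \<subseteq> edges G" "B \<subseteq> edges W" for A B
  proof -
    have "num_comps ?Z (A <+> B) = card (verts ?D // gen_equiv (verts ?D) (?J \<union> adj ?D (A <+> B)))"
      unfolding glue_def
    proof (rule num_comps_identify[OF wfD])
      show "A <+> B \<subseteq> edges ?D" using that by (auto simp: eD)
      show "?J \<subseteq> verts ?D \<times> verts ?D" unfolding vD using u(1) w by blast
    qed
    also have "\<dots> = card (verts G // gen_equiv (verts G) (T B \<union> adj G A)) + q B"
      unfolding vD adj_disjoint_union T_def q_def terminal_free_comps_def
      using card_quotient_glue[OF fin(1,2) disj' u(1) w adj_subset[OF G(1) that(1)]
        adj_subset[OF W that(2)]] .
    finally show ?thesis using num_comps_identify[OF G(1) that(1) T] by simp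
  qed
  \<comment> \<open>Gluing without edges: each of the \<open>k\<close> identifications loses one
    vertex.\<close>
  have vZ: "card (verts ?Z) + k = card (verts W) + card (verts G)"
  proof -
    have "card (verts W // gen_equiv (verts W) {}) = card (verts W)"
      by (simp add: quotient_gen_equiv_empty card_image)
    then show ?thesis
      using card_quotient_glue_discrete[OF fin(1,2) disj' u w, of "{}"]
      by (simp add: glue_def identify_def vD)
  qed
  \<comment> \<open>Double counting of the components of \<open>B\<close> glued to the edgeless
    vertex set of \<open>G\<close>: once by the general gluing formula with \<open>R\<close> empty,
    once by its discrete form.\<close>
  have vP: "card (verts (?P B)) + q B + k = num_comps W B + card (verts G)"
    if "B \<subseteq> edges W" for B
    using card_quotient_glue[OF fin(1,2) disj' u(1) w, of "{}" "adj W B"]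
      card_quotient_glue_discrete[OF fin(1,2) disj' u w, of "adj W B"] adj_subset[OF W that]
    by (simp add: identify_def T_def q_def terminal_free_comps_def num_comps_def)
  have c1: "num_comps (?P B) (edges G) = 1" for B
    using G T by (rule num_comps_identify_connected)
  have exps: "rank ?Z (edges G <+> edges W) - rank ?Z (A <+> B) =
        (q B - q (edges W)) + (rank (?P B) (edges (?P B)) - rank (?P B) A)"
      "card (A <+> B) - rank ?Z (A <+> B) = (card B - rank W B) + (card A - rank (?P B) A)"
    if A: "A \<subseteq> edges G" and B: "B \<subseteq> edges W" for A B
  proof -
    have eP: "edges (?P B) = edges G" by (simp add: identify_def)
    \<comment> \<open>Comparing component counts with all of \<open>G\<close> present gives
      monotonicity of \<open>q\<close>, so that \<open>q B - q (edges W)\<close> does not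
      truncate.\<close>
    have "num_comps ?Z (edges G <+> edges W) \<le> num_comps ?Z (edges G <+> B)"
      using B by (intro num_comps_antimono[OF finZ]) auto
    then have q: "q (edges W) \<le> q B" using B by (simp add: cZ c1)
    have le: "num_comps ?Z (A <+> B) \<le> card (verts ?Z)" "num_comps ?Z (edges G <+> edges W) \<le> card (verts ?Z)"
        "num_comps (?P B) A \<le> card (verts (?P B))" "num_comps W B \<le> card (verts W)"
      using finZ finP fin(2) by (auto intro: num_comps_le)
    \<comment> \<open>The corresponding bound for the identified graph, where the full edge set
      leaves one component.\<close>
    have ge: "num_comps (?P B) A \<ge> 1"
      using num_comps_antimono[OF finP A] c1 by metis
    have cE: "num_comps ?Z (edges G <+> edges W) = 1 + q (edges W)" by (simp add: cZ c1)
    show "rank ?Z (edges G <+> edges W) - rank ?Z (A <+> B) =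
        (q B - q (edges W)) + (rank (?P B) (edges (?P B)) - rank (?P B) A)"
      using q le ge cE cZ[OF A B] unfolding rank_def eP c1 by linarith
    \<comment> \<open>Rank is additive: in \<open>vZ\<close> and \<open>vP\<close> the terms
      \<open>q B\<close> and \<open>k\<close> cancel.\<close>
    have "rank ?Z (A <+> B) = rank (?P B) A + rank W B"
      using le cZ[OF A B] vZ vP[OF B] unfolding rank_def by linarith
    moreover have "rank (?P B) A \<le> card A" using wfP A by (intro rank_le_card) (auto simp: eP)
    moreover have "rank W B \<le> card B" using W B by (rule rank_le_card)
    moreover have "card (A <+> B) = card A + card B"
      using A B fin by (intro card_Plus) (auto intro: finite_subset)
    ultimately show "card (A <+> B) - rank ?Z (A <+> B) = (card B - rank W B) + (card A - rank (?P B) A)"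
      by linarith
  qed
  define f where "f C = (var_x - 1) ^ (rank ?Z (edges G <+> edges W) - rank ?Z C) *
    (var_y - 1) ^ (card C - rank ?Z C)" for C
  have "tutte_poly ?Z = (\<Sum>C\<in>Pow (edges G <+> edges W). f C)"
    by (simp add: tutte_poly_def eZ f_def)
  also have "\<dots> = (\<Sum>(B, A)\<in>Pow (edges W) \<times> Pow (edges G). f (A <+> B))"
    \<comment> \<open>The part in \<open>W\<close> comes first in the pair because it is the outer
      index of the double sum.\<close>
    by (subst sum.reindex_bij_betw[OF bij_betw_Plus_Pow, symmetric]) (simp add: case_prod_unfold)
  also have "\<dots> = (\<Sum>B\<in>Pow (edges W). \<Sum>A\<in>Pow (edges G). f (A <+> B))"
    by (simp add: sum.cartesian_product)
  also have "\<dots> = (\<Sum>B\<in>Pow (edges W). (var_x - 1) ^ (q B - q (edges W)) *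
      (var_y - 1) ^ (card B - rank W B) * tutte_poly (?P B))"
  proof (rule sum.cong[OF refl])
    fix B assume "B \<in> Pow (edges W)"
    then show "(\<Sum>A\<in>Pow (edges G). f (A <+> B)) = (var_x - 1) ^ (q B - q (edges W)) *
        (var_y - 1) ^ (card B - rank W B) * tutte_poly (?P B)"
      unfolding tutte_poly_def sum_distrib_left
      by (intro sum.cong) (auto simp: f_def exps power_add identify_def mult_ac)
  qed
  also have "\<dots> = (\<Sum>B\<in>Pow (edges W). (var_x - 1) ^ (q B - q (edges W)) * (var_y - 1) ^ (card B - rank W B) *
       tutte_poly (identify_partition G u (induced_partition ?I W w B)))"
    unfolding T_def identify_induced_partition[OF w] ..
  finally show ?thesis .
qed

theorem theorem3p3:
  fixes G :: "('v, 'e) mgraph" and H :: "('v, 'f) mgraph" and W :: "('v, 'g) mgraph"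
    and u v w :: "nat \<Rightarrow> 'v" and k :: nat
  assumes "wf_mgraph G" and "connected_mgraph G"
    and "wf_mgraph H" and "connected_mgraph H"
    and "verts G \<inter> verts H = {}"
    and "u ` {1..k} \<subseteq> verts G" and "inj_on u {1..k}"
    and "v ` {1..k} \<subseteq> verts H" and "inj_on v {1..k}"
    and "\<And>P. partition_on {1..k} P \<Longrightarrow>
           T_equivalent (identify_partition G u P) (identify_partition H v P)"
    and "wf_mgraph W"
    and "verts W \<inter> verts G = {}" and "verts W \<inter> verts H = {}"
    and "w ` {1..k} \<subseteq> verts W" and "inj_on w {1..k}"
  shows "T_equivalent (glue k G u W w) (glue k H v W w)"
  \<comment> \<open>Both expansions run over the same \<open>B\<close> with the same factors and the
    same induced partitions, so the hypothesis equates them term by term.\<close>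
  using assms(10)[OF partition_on_induced_partition[OF assms(14)]]
  unfolding T_equivalent_def
  by (simp add: tutte_poly_glue[OF assms(1,2,11,12,6,7,14)] tutte_poly_glue[OF assms(3,4,11,13,8,9,14)])

end
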